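(* Let $\lambda$ be a partition and $T$ a semistandard set-valued tableau of (straight) shape $\lambda$ with entries in $[m]$. Let $\mathsf{res}(T)=h^m\cdots h^1$ and let $[\mathbf{k},\mathbf{h}]^t$ be the corresponding decreasing Hecke biword. Apply Hecke row insertion from the right to $[\mathbf{k},\mathbf{h}]^t$ and obtain the pair of tableaux $(P,Q)$. Then $Q=T$.
   Context: Tableaux are in French notation; cell $(i,j)$ is in row $i$ (from the bottom), column $j$. A semistandard set-valued tableau fills each cell with a nonempty finite set of positive integers such that $\max(A)\leqslant\min(B)$ for horizontally adjacent cells $A$ left of $B$, and $\max(A)<\min(C)$ for vertically adjacent $A$ below $C$. Residue map: the content of cell $(i,j)$ of $\lambda$ is $\ell(\lambda)+j-i$ ($\ell(\lambda)$ = number of parts); $\mathsf{res}(T)=h^m\cdots h^1$ where $h^k=h^k_1h^k_2\cdots h^k_{\ell_k}$ lists in decreasing order the contents of the cells of $T$ containing $k$. The decreasing Hecke biword of $h^m\cdots h^1$ is the two-row array whose columns, from left to right, are $[m;h^m_1],\dots,[m;h^m_{\ell_m}],[m-1;h^{m-1}_1],\dots,[1;h^1_1],\dots,[1;h^1_{\ell_1}]$ (top entry; bottom entry). Hecke row insertion from the right: start with $P_0,Q_0$ empty; read the columns right to left; if the current column is $[y;x]$, insert $x$ into the first row of $P_i$ by the following rules for inserting $x$ into a row $R$. (1) If $x\geqslant z$ for all $z\in R$: (a) if appending $x$ to the right end of $R$ gives an increasing tableau (rows and columns strictly increasing), do so and add a cell containing $y$ to $Q_i$ in the same position; stop. (b)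 Otherwise $R$ is unchanged, $y$ is added to the set in the existing corner cell of $Q_i$ whose column contains the rightmost box of $R$; stop. (2) Otherwise let $z$ be the smallest entry of $R$ with $z>x$: (a) if replacing $z$ by $x$ gives an increasing tableau, do so, and insert $z$ into the next row up; (b) otherwise leave $R$ unchanged and insert $z$ into the next row up. After all columns are processed one obtains $(P,Q)$. *)

theory Defs
  imports Main
begin

text \<open>
  Tableaux in French notation are lists of rows, bottom row first; rows and columns are numbered
  from 0. The content of a cell depends only on the difference of its coordinates, so it agrees
  with the content computed from coordinates starting at 1.
\<close>

definition is_partition :: "nat list \<Rightarrow> bool" where
  "is_partition lam \<longleftrightarrow> sorted_wrt (\<ge>) lam \<and> 0 \<notin> set lam"

definition shape :: "'a list list \<Rightarrow> nat list" where
  "shape T = map length T"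

definition cells :: "nat list \<Rightarrow> (nat \<times> nat) set" where
  "cells lam = {(i, j). i < length lam \<and> j < lam ! i}"

definition is_corner :: "nat list \<Rightarrow> nat \<times> nat \<Rightarrow> bool" where
  "is_corner lam = (\<lambda>(i, j). (i, j) \<in> cells lam \<and> (Suc i, j) \<notin> cells lam \<and> (i, Suc j) \<notin> cells lam)"

definition semistandard_set_valued :: "nat list \<Rightarrow> nat set list list \<Rightarrow> bool" where
  "semistandard_set_valued lam T \<longleftrightarrow>
     shape T = lam \<and>
     (\<forall>(i, j) \<in> cells lam. finite (T ! i ! j) \<and> T ! i ! j \<noteq> {} \<and> (\<forall>a \<in> T ! i ! j. 0 < a)) \<and>
     (\<forall>i j. (i, j) \<in> cells lam \<and> (i, Suc j) \<in> cells lam \<longrightarrow>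
        Max (T ! i ! j) \<le> Min (T ! i ! Suc j)) \<and>
     (\<forall>i j. (i, j) \<in> cells lam \<and> (Suc i, j) \<in> cells lam \<longrightarrow>
        Max (T ! i ! j) < Min (T ! Suc i ! j))"

definition entries :: "nat set list list \<Rightarrow> nat set" where
  "entries T = (\<Union>(i, j) \<in> cells (shape T). T ! i ! j)"

definition content :: "nat list \<Rightarrow> nat \<times> nat \<Rightarrow> nat" where
  "content lam = (\<lambda>(i, j). length lam + j - i)"

text \<open>
  In a semistandard set-valued tableau the cells containing a given \<open>k\<close> have pairwise distinct
  contents, so collecting the contents in a set loses nothing.
\<close>

definition res_factor :: "nat set list list \<Rightarrow> nat \<Rightarrow> nat list" where
  "res_factor T k =
     rev (sorted_list_of_set
       (content (shape T) ` {(i, j). (i, j) \<in> cells (shape T) \<and> k \<in> T ! i ! j}))"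

text \<open>The word $h^m \cdots h^1$ is the list of its factors, starting with $h^m$.\<close>

definition res :: "nat \<Rightarrow> nat set list list \<Rightarrow> nat list list" where
  "res m T = map (res_factor T) (rev [1..<Suc m])"

definition hecke_biword :: "nat list list \<Rightarrow> (nat \<times> nat) list" where
  "hecke_biword hs =
     concat (map2 (\<lambda>k h. map (\<lambda>x. (k, x)) h) (rev [1..<Suc (length hs)]) hs)"

definition increasing_tableau :: "nat list list \<Rightarrow> bool" where
  "increasing_tableau P \<longleftrightarrow>
     is_partition (shape P) \<and>
     (\<forall>i j. (i, j) \<in> cells (shape P) \<and> (i, Suc j) \<in> cells (shape P) \<longrightarrow> P ! i ! j < P ! i ! Suc j) \<and>
     (\<forall>i j. (i, j) \<in> cells (shape P) \<and> (Suc i, j) \<in> cells (shape P) \<longrightarrow> P ! i ! j < P ! Suc i ! j)"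

text \<open>The row just above the top row of a tableau is empty, and a box may be appended to it.\<close>

definition row :: "'a list list \<Rightarrow> nat \<Rightarrow> 'a list" where
  "row T r = (if r < length T then T ! r else [])"

definition append_to_row :: "nat \<Rightarrow> 'a \<Rightarrow> 'a list list \<Rightarrow> 'a list list" where
  "append_to_row r a T = (if r < length T then T[r := T ! r @ [a]] else T @ [[a]])"

definition replace_in_row :: "nat \<Rightarrow> nat \<Rightarrow> nat \<Rightarrow> nat list list \<Rightarrow> nat list list" where
  "replace_in_row r z x P = P[r := map (\<lambda>w. if w = z then x else w) (P ! r)]"

definition add_to_corner :: "nat \<Rightarrow> nat \<Rightarrow> nat set list list \<Rightarrow> nat set list list" where
  "add_to_corner j y Q =
     (let i = (THE i. is_corner (shape Q) (i, j)) in Q[i := (Q ! i)[j := insert y (Q ! i ! j)]])"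

text \<open>
  \<open>hecke_insert_row y r x (P, Q)\<close> inserts \<open>x\<close> into row \<open>r\<close> of \<open>P\<close> and continues upwards until the
  insertion stops, recording \<open>y\<close> in \<open>Q\<close>.
\<close>

function hecke_insert_row ::
  "nat \<Rightarrow> nat \<Rightarrow> nat \<Rightarrow> nat list list \<times> nat set list list \<Rightarrow> nat list list \<times> nat set list list"
where
  "hecke_insert_row y r x (P, Q) =
    (if \<forall>z \<in> set (row P r). z \<le> x
     then
       (if increasing_tableau (append_to_row r x P)
        then (append_to_row r x P, append_to_row r {y} Q)
        else (P, add_to_corner (length (row P r) - 1) y Q))
     else
       (let z = Min {z \<in> set (row P r). x < z}; P' = replace_in_row r z x P in
          if increasing_tableau P'
          then hecke_insert_row y (Suc r) z (P', Q)
          else hecke_insert_row y (Suc r) z (P, Q)))"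
  by pat_completeness auto
termination
  by (relation "measure (\<lambda>(y, r, x, P, Q). length P - r)")
    (auto simp: row_def replace_in_row_def split: if_splits)

text \<open>\<open>foldr\<close> processes the columns of the biword from right to left.\<close>

definition hecke_insertion :: "(nat \<times> nat) list \<Rightarrow> nat list list \<times> nat set list list" where
  "hecke_insertion w = foldr (\<lambda>(y, x). hecke_insert_row y 0 x) w ([], [])"

end

theory Submission
  imports Defs
begin

text \<open>
  Processing the pairs (entry, content) of \<open>T\<close> in increasing lexicographic order builds up \<open>T\<close> itself,
  one entry at a time, and semistandardness makes the affected cell \<open>(r, j)\<close> either an addable cell or
  a corner of the shape reached so far. Meanwhile column \<open>j\<close> of the insertion tableau lists the contents
  of column \<open>j\<close> in reverse order. If \<open>(r, j)\<close> is addable, its content bumps exactly the entries of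
  column \<open>j\<close>, lowering each by one, and a new box appears at \<open>(r, j)\<close>. If it is a corner, its content is
  already the bottom entry of column \<open>j\<close>; the bumping path then runs up column \<open>j + 1\<close> without
  changing it and ends in a row whose last box is in column \<open>j\<close>, so that the corner \<open>(r, j)\<close>
  receives the entry.
\<close>

declare hecke_insert_row.simps [simp del]

section \<open>Cells of a partition\<close>

lemma nat_eqI_less: "(\<And>i :: nat. i < m \<longleftrightarrow> i < n) \<Longrightarrow> m = n"
  by (metis linorder_neqE_nat less_irrefl)

lemma cells_iff: "(i, j) \<in> cells lam \<longleftrightarrow> i < length lam \<and> j < lam ! i"
  by (simp add: cells_def)

lemma cells_shape_iff: "(i, j) \<in> cells (shape P) \<longleftrightarrow> i < length P \<and> j < length (P ! i)"
  by (auto simp: cells_def shape_def)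

lemma finite_cells: "finite (cells lam)"
proof -
  have "cells lam = (SIGMA i:{..<length lam}. {..<lam ! i})"
    by (auto simp: cells_def)
  then show ?thesis by simp
qed

lemma is_partition_iff_nth:
  "is_partition lam \<longleftrightarrow>
     (\<forall>i. Suc i < length lam \<longrightarrow> lam ! Suc i \<le> lam ! i) \<and> (\<forall>i < length lam. 0 < lam ! i)"
proof -
  have "transp (\<lambda>x y :: nat. y \<le> x)"
    by (auto simp: transp_def)
  then have "sorted_wrt (\<ge>) lam \<longleftrightarrow> (\<forall>i. Suc i < length lam \<longrightarrow> lam ! Suc i \<le> lam ! i)"
    by (rule sorted_wrt_iff_nth_Suc_transp)
  moreover have "0 \<notin> set lam \<longleftrightarrow> (\<forall>i < length lam. 0 < lam ! i)"
    by (metis in_set_conv_nth neq0_conv)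
  ultimately show ?thesis
    by (auto simp: is_partition_def)
qed

lemma cells_downward_closed:
  assumes "is_partition lam" "(i, j) \<in> cells lam" "i' \<le> i" "j' \<le> j"
  shows "(i', j') \<in> cells lam"
proof -
  have "lam ! i \<le> lam ! i'"
    using assms by (cases "i' = i") (auto simp: is_partition_def cells_iff sorted_wrt_iff_nth_less)
  then show ?thesis
    using assms by (auto simp: cells_iff)
qed

text \<open>Parts are positive, so row \<open>i\<close> exists exactly when it has a cell in column
  0. This fixes the number of parts, and then each row fixes its part.\<close>

lemma cells_inject:
  assumes "is_partition lam" "is_partition mu" "cells lam = cells mu"
  shows "lam = mu"
proof -
  have eq: "i < length lam \<and> j < lam ! i \<longleftrightarrow> i < length mu \<and> j < mu ! i" for i j
    using assms(3) by (metis cells_iff)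
  have "i < length lam \<longleftrightarrow> i < length mu" for i
    using eq[of i 0] assms(1,2) by (auto simp: is_partition_iff_nth)
  then have len: "length lam = length mu"
    by (blast intro: nat_eqI_less)
  show ?thesis
  proof (rule nth_equalityI[OF len])
    fix i assume "i < length lam"
    then have "j < lam ! i \<longleftrightarrow> j < mu ! i" for j
      using eq[of i j] len by auto
    then show "lam ! i = mu ! i"
      by (blast intro: nat_eqI_less)
  qed
qed

lemma shape_append_to_row:
  "shape (append_to_row r x P) =
     (if r < length (shape P) then (shape P)[r := Suc (shape P ! r)] else shape P @ [1])"
  by (simp add: shape_def append_to_row_def map_update)

text \<open>For a partition these are the parts of the conjugate partition, extended by 0 to the
  columns outside the diagram.\<close>

definition column_height :: "nat list \<Rightarrow> nat \<Rightarrow> nat" where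
  "column_height lam j = card {i. (i, j) \<in> cells lam}"

text \<open>The rows meeting a column form a finite initial segment of the naturals, hence
  \<open>{..<n}\<close> with \<open>n\<close> its cardinality. Membership of a cell thereby becomes
  a linear inequality.\<close>

lemma less_column_height_iff:
  assumes "is_partition lam"
  shows "i < column_height lam j \<longleftrightarrow> (i, j) \<in> cells lam"
proof -
  define A where "A = {i. (i, j) \<in> cells lam}"
  have fin: "finite A"
    by (rule finite_subset[of _ "{..<length lam}"]) (auto simp: A_def cells_iff)
  have down: "i' \<in> A" if "i \<in> A" "i' \<le> i" for i i'
    using that cells_downward_closed[OF assms] by (auto simp: A_def)
  have "i \<in> A \<longleftrightarrow> i < card A" for i
  proof
    assume "i \<in> A"
    then have "{..i} \<subseteq> A" using down by auto
    from card_mono[OF fin this] show "i < card A" by simp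
  next
    assume *: "i < card A"
    show "i \<in> A"
    proof (rule ccontr)
      assume "i \<notin> A"
      then have "A \<subseteq> {..<i}" using down by (auto simp: linorder_not_le[symmetric])
      from card_mono[OF _ this] * show False by simp
    qed
  qed
  then show ?thesis unfolding column_height_def A_def by blast
qed

lemma column_height_antimono:
  assumes "is_partition lam" "j \<le> j'"
  shows "column_height lam j' \<le> column_height lam j"
proof (rule ccontr)
  assume "\<not> ?thesis"
  then have "(column_height lam j, j') \<in> cells lam"
    by (simp add: less_column_height_iff[OF assms(1), symmetric])
  then have "(column_height lam j, j) \<in> cells lam"
    using cells_downward_closed[OF assms(1)] assms(2) by blast
  then show False
    by (simp add: less_column_height_iff[OF assms(1), symmetric])
qed

section \<open>Addable cells\<close>

definition addable :: "nat list \<Rightarrow> nat \<Rightarrow> nat \<Rightarrow> bool" where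
  "addable lam r j \<longleftrightarrow> (r, j) \<notin> cells lam \<and> (\<forall>i < r. (i, j) \<in> cells lam) \<and> (\<forall>i < j. (r, i) \<in> cells lam)"

text \<open>The alternatives match the two branches of \<open>append_to_row\<close>: a box at the
  end of an existing row, or one that opens a new row.\<close>

lemma addable_row:
  assumes "is_partition lam" "addable lam r j"
  shows "r < length lam \<and> lam ! r = j \<and> 0 < j \<or> r = length lam \<and> j = 0"
proof (cases j)
  case 0
  have "r \<ge> length lam"
    using assms 0 by (auto simp: addable_def cells_iff is_partition_iff_nth intro: leI)
  moreover have "r \<le> length lam"
    using assms(2) by (cases r) (auto simp: addable_def cells_iff)
  ultimately show ?thesis using 0 by simp
next
  case (Suc j')
  then have "(r, j') \<in> cells lam" "(r, j) \<notin> cells lam"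
    using assms by (auto simp: addable_def)
  then show ?thesis using Suc by (auto simp: cells_iff)
qed

lemma addable_row_shape:
  assumes "is_partition (shape P)" "addable (shape P) r j"
  shows "r < length P \<and> length (P ! r) = j \<or> r = length P \<and> j = 0"
  using addable_row[OF assms] by (auto simp: shape_def)

lemma append_to_row_addable:
  assumes part: "is_partition (shape P)" and add: "addable (shape P) r j"
  shows length_row_addable: "length (row P r) = j"
    and cells_append_to_row: "cells (shape (append_to_row r x P)) = insert (r, j) (cells (shape P))"
    and nth_append_to_row: "append_to_row r x P ! r ! j = x"
    and nth_append_to_row_other:
      "\<And>a b. (a, b) \<in> cells (shape P) \<Longrightarrow> append_to_row r x P ! a ! b = P ! a ! b"
    and is_partition_append_to_row: "is_partition (shape (append_to_row r x P))"
    and column_height_append_to_row: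
      "\<And>b. column_height (shape (append_to_row r x P)) b =
         (if b = j then Suc r else column_height (shape P) b)"
    and column_height_addable: "column_height (shape P) j = r"
proof -
  note cases = addable_row_shape[OF part add]
  show "length (row P r) = j"
    using cases by (auto simp: row_def)
  show cells: "cells (shape (append_to_row r x P)) = insert (r, j) (cells (shape P))"
    using cases by (auto simp: cells_shape_iff append_to_row_def nth_list_update nth_append less_Suc_eq
        split: if_splits)
  show "append_to_row r x P ! r ! j = x"
    using cases by (auto simp: append_to_row_def nth_append)
  show "append_to_row r x P ! a ! b = P ! a ! b" if "(a, b) \<in> cells (shape P)" for a b
    using cases that by (auto simp: append_to_row_def nth_append cells_shape_iff nth_list_update)
  have below: "i < r \<Longrightarrow> j < length (P ! i)" "i < r \<Longrightarrow> i < length P" for i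
    using add by (auto simp: addable_def cells_shape_iff)
  show part': "is_partition (shape (append_to_row r x P))"
    using cases part below
    by (auto simp: is_partition_iff_nth append_to_row_def shape_def nth_append nth_list_update
        Suc_le_eq less_Suc_eq_le)
  \<comment> \<open>Downward closure rules out cells of column \<open>j\<close> above the missing
    cell \<open>(r, j)\<close>.\<close>
  have rj: "i < column_height (shape P) j \<longleftrightarrow> i < r" for i
    using add cells_downward_closed[OF part, of i j r j]
    by (auto simp: less_column_height_iff[OF part] addable_def linorder_not_less[symmetric])
  then show ht: "column_height (shape P) j = r"
    by (blast intro: nat_eqI_less)
  have "i < column_height (shape (append_to_row r x P)) b \<longleftrightarrow>
      i < (if b = j then Suc r else column_height (shape P) b)" for i b
    using rj[of i]
    by (auto simp: less_column_height_iff[OF part'] less_column_height_iff[OF part] cells less_Suc_eq)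
  then show "column_height (shape (append_to_row r x P)) b =
         (if b = j then Suc r else column_height (shape P) b)" for b
    by (blast intro: nat_eqI_less)
qed

section \<open>Tableaux with reversed contents in their columns\<close>

text \<open>
  With \<open>i = 0\<close> (and then any \<open>j\<close>) this says that each column lists its contents in reverse order;
  the parameters describe the stage at which the insertion of a new cell on top of column \<open>j\<close> has
  already lowered that column in the rows below \<open>i\<close>.
\<close>

definition reversed_contents :: "nat \<Rightarrow> nat \<Rightarrow> nat \<Rightarrow> nat list list \<Rightarrow> bool" where
  "reversed_contents l i j P \<longleftrightarrow> is_partition (shape P) \<and>
     (\<forall>(a, b) \<in> cells (shape P).
        P ! a ! b + column_height (shape P) b + (if b = j \<and> a < i then 1 else 0) = Suc (l + b + a))"

lemma reversed_contentsD:
  assumes "reversed_contents l i j P" "(a, b) \<in> cells (shape P)"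
  shows "P ! a ! b + column_height (shape P) b + (if b = j \<and> a < i then 1 else 0) = Suc (l + b + a)"
  using assms by (auto simp: reversed_contents_def)

text \<open>Up to the lowering, the entry in \<open>(a, b)\<close> is \<open>l + b + a + 1\<close>
  minus the height of column \<open>b\<close>, and heights weakly decrease to the right. Only a
  lowered column \<open>j\<close> could lose strictness, and there addability makes column
  \<open>j - 1\<close> strictly higher than column \<open>j\<close>.\<close>

lemma reversed_contents_row_less:
  assumes P: "reversed_contents l i j P" and strict: "i = 0 \<or> addable (shape P) r j"
    and "(a, Suc b) \<in> cells (shape P)"
  shows "P ! a ! b < P ! a ! Suc b"
proof -
  have part: "is_partition (shape P)" using P by (simp add: reversed_contents_def)
  have "column_height (shape P) (Suc b) \<le> column_height (shape P) b"
    by (rule column_height_antimono[OF part]) simp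
  moreover have "column_height (shape P) (Suc b) < column_height (shape P) b" if "Suc b = j" "i \<noteq> 0"
  proof -
    have "addable (shape P) r j" using strict that by simp
    then show ?thesis
      using that column_height_addable[OF part] less_column_height_iff[OF part, of r b]
      by (auto simp: addable_def)
  qed
  moreover have "(a, b) \<in> cells (shape P)"
    by (rule cells_downward_closed[OF part assms(3)]) auto
  ultimately show ?thesis
    using reversed_contentsD[OF P, of a b] reversed_contentsD[OF P assms(3)]
    by (auto split: if_splits)
qed

lemma reversed_contents_row_mono:
  assumes P: "reversed_contents l i j P" and strict: "i = 0 \<or> addable (shape P) r j"
    and "(a, b') \<in> cells (shape P)" "b < b'"
  shows "P ! a ! b < P ! a ! b'"
proof -
  have part: "is_partition (shape P)" using P by (simp add: reversed_contents_def)
  show ?thesis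
    using assms(4,3)
  proof (induction b')
    case (Suc b')
    have "P ! a ! b' < P ! a ! Suc b'"
      using reversed_contents_row_less[OF P strict Suc.prems(2)] .
    moreover have "(a, b') \<in> cells (shape P)"
      by (rule cells_downward_closed[OF part Suc.prems(2)]) auto
    ultimately show ?case
      using Suc by (cases "b = b'") auto
  qed simp
qed

text \<open>Up a column the entries grow by one, and by two where the lowered part of column
  \<open>j\<close> ends.\<close>

lemma increasing_tableau_reversed_contents:
  assumes P: "reversed_contents l i j P" and strict: "i = 0 \<or> addable (shape P) r j"
  shows "increasing_tableau P"
  unfolding increasing_tableau_def
proof (intro conjI allI impI; (elim conjE)?)
  show "is_partition (shape P)" using P by (simp add: reversed_contents_def)
next
  fix a b assume "(a, Suc b) \<in> cells (shape P)"
  then show "P ! a ! b < P ! a ! Suc b"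
    using reversed_contents_row_less[OF P strict] by simp
next
  fix a b assume "(a, b) \<in> cells (shape P)" "(Suc a, b) \<in> cells (shape P)"
  then show "P ! a ! b < P ! Suc a ! b"
    using reversed_contentsD[OF P, of a b] reversed_contentsD[OF P, of "Suc a" b]
    by (auto split: if_splits)
qed

section \<open>Insertion that adds a cell\<close>

lemma Min_greater_in_row:
  assumes mono: "\<And>b b'. b < b' \<Longrightarrow> b' < length R \<Longrightarrow> R ! b < R ! b'"
    and "j < length R" "x < R ! j" "\<And>b. b < j \<Longrightarrow> R ! b \<le> x"
  shows "Min {z \<in> set R. x < z} = (R ! j :: nat)"
proof (rule Min_eqI)
  fix z assume "z \<in> {z \<in> set R. x < z}"
  then obtain b where b: "b < length R" "z = R ! b" "x < z"
    by (auto simp: in_set_conv_nth)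
  then have "\<not> b < j" using assms(4)[of b] by auto
  then show "R ! j \<le> z" using b mono[of j b] by (cases "b = j") auto
qed (use assms in auto)

text \<open>Replacement acts on every occurrence of a value; strictness of the row confines it to
  one position.\<close>

lemma nth_replace_in_row:
  assumes mono: "\<And>b b'. b < b' \<Longrightarrow> b' < length (P ! i) \<Longrightarrow> P ! i ! b < P ! i ! b'"
    and "(i, j) \<in> cells (shape P)" "(a, b) \<in> cells (shape P)"
  shows "replace_in_row i (P ! i ! j) x P ! a ! b = (if a = i \<and> b = j then x else P ! a ! b)"
proof -
  have "P ! i ! b \<noteq> P ! i ! j" if "a = i" "b \<noteq> j"
    using that assms(2,3) mono[of b j] mono[of j b]
    by (metis cells_shape_iff less_irrefl linorder_neqE_nat)
  then show ?thesis
    using assms(2,3) by (auto simp: replace_in_row_def cells_shape_iff nth_list_update)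
qed

lemma shape_list_update:
  assumes "length R = length (P ! i)"
  shows "shape (P[i := R]) = shape P"
proof (cases "i < length P")
  case True
  then have "(map length P)[i := length (P ! i)] = map length P"
    using list_update_id[of "map length P" i] by simp
  then show ?thesis using assms by (simp add: shape_def map_update)
qed (simp add: list_update_beyond)

lemma shape_replace_in_row: "shape (replace_in_row i z x P) = shape P"
  by (simp add: replace_in_row_def shape_list_update)

text \<open>For \<open>i < r\<close> the equation on \<open>x\<close> says that \<open>x\<close> is
  one less than the entry in \<open>(i, j)\<close>. Each row below \<open>r\<close> thus trades
  \<open>x + 1\<close> for \<open>x\<close> in column \<open>j\<close> and passes
  \<open>x + 1\<close> on, which preserves the equation; row \<open>r\<close> receives
  \<open>l + j\<close> and appends it.\<close>

lemma hecke_insert_row_addable_aux: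
  assumes "reversed_contents l i j P" "addable (shape P) r j" "i \<le> r" "x + r = l + j + i"
  shows "\<exists>P'. hecke_insert_row y i x (P, Q) = (P', append_to_row r {y} Q) \<and>
     reversed_contents l 0 j P' \<and> shape P' = shape (append_to_row r x P)"
  using assms(3,1,2,4)
proof (induction i arbitrary: x P rule: inc_induct)
  case base
  note P = base(1) and add = base(2)
  then have part: "is_partition (shape P)" by (simp add: reversed_contents_def)
  note append = append_to_row_addable[OF part add]
  have le: "z \<le> x" if z: "z \<in> set (row P r)" for z
  proof -
    obtain b where b: "b < j" "z = P ! r ! b" and r: "r < length P"
      using z append(1) by (auto simp: in_set_conv_nth row_def split: if_splits)
    then have cell: "(r, b) \<in> cells (shape P)" using add by (simp add: addable_def)
    \<comment> \<open>Columns left of \<open>j\<close> have at least \<open>r + 1\<close> boxes, so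
      their entries in row \<open>r\<close> are at most \<open>l + b < l + j = x\<close>.\<close>
    then have "r < column_height (shape P) b" using less_column_height_iff[OF part] by blast
    then show ?thesis using reversed_contentsD[OF P cell] b base(3) by auto
  qed
  \<comment> \<open>The new box raises column \<open>j\<close> to height \<open>r + 1\<close>. This
    compensates exactly for the lowering of the entries below row \<open>r\<close>, so the stage
    returns to 0.\<close>
  have P': "reversed_contents l 0 j (append_to_row r x P)"
    unfolding reversed_contents_def append(6)
  proof (intro conjI ballI, rule append(5), clarify)
    fix a b assume "(a, b) \<in> cells (shape (append_to_row r x P))"
    then consider "a = r" "b = j" | "(a, b) \<in> cells (shape P)" "b = j" "a < r"
      | "(a, b) \<in> cells (shape P)" "b \<noteq> j"
      using append(2,7) less_column_height_iff[OF part] by auto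
    then show "append_to_row r x P ! a ! b + (if b = j then Suc r else column_height (shape P) b) +
          (if b = j \<and> a < 0 then 1 else 0) = Suc (l + b + a)"
      using reversed_contentsD[OF P, of a b] append(3,4,7) base(3) by cases auto
  qed
  then have "increasing_tableau (append_to_row r x P)"
    using increasing_tableau_reversed_contents by blast
  then have "hecke_insert_row y r x (P, Q) = (append_to_row r x P, append_to_row r {y} Q)"
    using le by (subst hecke_insert_row.simps) simp
  then show ?case using P' by blast
next
  case (step i)
  note P = step.prems(1) and add = step.prems(2)
  then have part: "is_partition (shape P)" by (simp add: reversed_contents_def)
  note append = append_to_row_addable[OF part add]
  have cell: "(i, j) \<in> cells (shape P)" using add step.hyps by (simp add: addable_def)
  then have row: "row P i = P ! i" and j: "j < length (P ! i)"
    by (auto simp: cells_shape_iff row_def)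
  have mono: "P ! i ! b < P ! i ! b'" if "b < b'" "b' < length (P ! i)" for b b'
    using reversed_contents_row_mono[OF P, of r i b' b] that add cell by (auto simp: cells_shape_iff)
  have z: "P ! i ! j = Suc x"
    using reversed_contentsD[OF P cell] step.prems(3) append(7) by simp
  have Min: "Min {z \<in> set (P ! i). x < z} = Suc x"
    using Min_greater_in_row[of "P ! i" j x] mono j z by (metis less_Suc_eq_le lessI)
  define P' where "P' = replace_in_row i (Suc x) x P"
  have nth: "P' ! a ! b = (if a = i \<and> b = j then x else P ! a ! b)"
    if "(a, b) \<in> cells (shape P)" for a b
    using nth_replace_in_row[of P i j a b x] mono cell that z by (simp add: P'_def)
  have shape: "shape P' = shape P" by (simp add: P'_def shape_replace_in_row)
  have P': "reversed_contents l (Suc i) j P'"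
    unfolding reversed_contents_def shape
  proof (intro conjI ballI part, clarify)
    fix a b assume ab: "(a, b) \<in> cells (shape P)"
    show "P' ! a ! b + column_height (shape P) b + (if b = j \<and> a < Suc i then 1 else 0) = Suc (l + b + a)"
      using reversed_contentsD[OF P ab] nth[OF ab] z by (auto simp: less_Suc_eq split: if_splits)
  qed
  have add': "addable (shape P') r j" using add shape by simp
  have "increasing_tableau P'"
    using increasing_tableau_reversed_contents[OF P'] add' by blast
  moreover have "\<not> (\<forall>z \<in> set (row P i). z \<le> x)"
    using z j row by (metis Suc_n_not_le_n nth_mem)
  ultimately have "hecke_insert_row y i x (P, Q) = hecke_insert_row y (Suc i) (Suc x) (P', Q)"
    by (subst hecke_insert_row.simps) (auto simp: row Min P'_def Let_def)
  moreover have "shape (append_to_row r (Suc x) P') = shape (append_to_row r x P)"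
  proof (rule cells_inject)
    show "is_partition (shape (append_to_row r (Suc x) P'))"
      using append_to_row_addable(5)[of P'] add' part shape by simp
    show "cells (shape (append_to_row r (Suc x) P')) = cells (shape (append_to_row r x P))"
      using append_to_row_addable(2)[of P' r j] add' part append(2) shape by simp
  qed (rule append(5))
  ultimately show ?case
    using step.IH[OF P' add', of "Suc x"] step.prems(3) by simp
qed

lemma hecke_insert_row_addable:
  assumes "reversed_contents l 0 j P" "shape Q = shape P" "addable (shape P) r j" "x + r = l + j"
    "hecke_insert_row y 0 x (P, Q) = (P', Q')"
  shows "Q' = append_to_row r {y} Q" "reversed_contents l 0 j P'" "shape P' = shape Q'"
proof -
  have "shape (append_to_row r x P) = shape (append_to_row r {y} Q)"
    using assms(2) by (simp add: shape_append_to_row)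
  then show "Q' = append_to_row r {y} Q" "reversed_contents l 0 j P'" "shape P' = shape Q'"
    using hecke_insert_row_addable_aux[OF assms(1,3), of x y Q] assms(4,5) by auto
qed

section \<open>Insertion that ends at a corner\<close>

lemma is_corner_iff_column_height:
  assumes "is_partition lam"
  shows "is_corner lam (r, j) \<longleftrightarrow>
    column_height lam j = Suc r \<and> column_height lam (Suc j) \<le> r"
  unfolding is_corner_def less_column_height_iff[OF assms, symmetric] prod.case by linarith

text \<open>The height of a column determines the row of its only possible corner, so the
  description \<open>THE i\<close> in \<open>add_to_corner\<close> denotes \<open>r\<close>.\<close>

lemma add_to_corner_eq:
  assumes "is_partition (shape Q)" "is_corner (shape Q) (r, j)"
  shows "add_to_corner j y Q = Q[r := (Q ! r)[j := insert y (Q ! r ! j)]]"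
proof -
  have "(THE i. is_corner (shape Q) (i, j)) = r"
    using assms by (auto simp: is_corner_iff_column_height intro!: the_equality)
  then show ?thesis by (simp add: add_to_corner_def)
qed

text \<open>In row 0 the inserted \<open>x\<close> equals the entry of column \<open>j\<close>; in a
  higher row \<open>i\<close> it equals the entry of \<open>(i - 1, j + 1)\<close>, just passed up.
  Placing it in column \<open>j + 1\<close> would make two adjacent entries equal, so
  \<open>P\<close> never changes. The path stops in row \<open>s\<close>, the first without a box in
  column \<open>j + 1\<close>; its last box lies in column \<open>j\<close>, whose corner receives
  \<open>y\<close>.\<close>

lemma hecke_insert_row_corner_aux:
  assumes "reversed_contents l 0 j P" "is_corner (shape P) (r, j)"
    "s = column_height (shape P) (Suc j)"
    "i \<le> s" "if i = 0 then x + r = l + j else x + s = Suc (l + j + i)"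
  shows "hecke_insert_row y i x (P, Q) = (P, add_to_corner j y Q)"
proof -
  note P = assms(1)
  then have part: "is_partition (shape P)" by (simp add: reversed_contents_def)
  have "s \<le> r" and ht: "column_height (shape P) j = Suc r"
    using assms(2,3) is_corner_iff_column_height[OF part] by auto
  have cell: "(i, j) \<in> cells (shape P)" if "i \<le> r" for i
    using that ht by (simp add: less_column_height_iff[OF part, symmetric])
  have right: "(i, Suc j) \<in> cells (shape P)" if "i < s" for i
    using that assms(3) by (simp add: less_column_height_iff[OF part, symmetric])
  have above: "(s, Suc j) \<notin> cells (shape P)"
    using assms(3) by (simp add: less_column_height_iff[OF part, symmetric])
  have ent: "P ! i ! j + r = l + j + i" if "i \<le> r" for i
    using reversed_contentsD[OF P cell[OF that]] ht by simp
  have ent_right: "P ! i ! Suc j + s = Suc (Suc (l + j + i))" if "i < s" for i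
    using reversed_contentsD[OF P right[OF that]] assms(3) by simp
  have mono: "P ! i ! b < P ! i ! b'" if "(i, b') \<in> cells (shape P)" "b < b'" for i b' b
    using reversed_contents_row_mono[OF P _ that] by simp
  show ?thesis
    using assms(4,5)
  proof (induction i arbitrary: x rule: inc_induct)
    case base
    have row: "row P s = P ! s" and len: "length (P ! s) = Suc j" and s: "s < length P"
      using cell[of s] above \<open>s \<le> r\<close> by (auto simp: cells_shape_iff row_def)
    have le: "z \<le> x" if "z \<in> set (P ! s)" for z
    proof -
      obtain b where b: "b \<le> j" "z = P ! s ! b"
        using \<open>z \<in> set (P ! s)\<close> len by (auto simp: in_set_conv_nth less_Suc_eq_le)
      then have "z \<le> P ! s ! j"
        using mono[of s j b] cell[of s] \<open>s \<le> r\<close> by (cases "b = j") auto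
      then show ?thesis using ent[of s] base \<open>s \<le> r\<close> by (auto split: if_splits)
    qed
    \<comment> \<open>A copy of \<open>x\<close> would sit immediately to the left if
      \<open>s = 0\<close>, and immediately below otherwise.\<close>
    have "\<not> increasing_tableau (append_to_row s x P)"
    proof
      assume incr: "increasing_tableau (append_to_row s x P)"
      have app: "append_to_row s x P = P[s := P ! s @ [x]]" using s by (simp add: append_to_row_def)
      have new: "append_to_row s x P ! s ! Suc j = x" "(s, Suc j) \<in> cells (shape (append_to_row s x P))"
        using s len by (auto simp: app cells_shape_iff nth_append)
      show False
      proof (cases s)
        case 0
        then have "P ! s ! j = x" using ent[of s] base by simp
        then have "append_to_row s x P ! s ! j = x" "(s, j) \<in> cells (shape (append_to_row s x P))"
          using s len \<open>P ! s ! j = x\<close> by (auto simp: app cells_shape_iff nth_append)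
        then show False using incr new unfolding increasing_tableau_def by (metis less_irrefl)
      next
        case (Suc i)
        then have "P ! i ! Suc j = x" using ent_right[of i] base by simp
        then have "append_to_row s x P ! i ! Suc j = x" "(i, Suc j) \<in> cells (shape (append_to_row s x P))"
          using s right[of i] Suc unfolding app by (auto simp: cells_shape_iff)
        then show False using incr new Suc unfolding increasing_tableau_def by (metis less_irrefl)
      qed
    qed
    then show ?case
      using le by (subst hecke_insert_row.simps) (simp add: row len)
  next
    case (step i)
    have ir: "i \<le> r" using step.hyps \<open>s \<le> r\<close> by simp
    have cellR: "(i, Suc j) \<in> cells (shape P)" using right step.hyps by simp
    then have row: "row P i = P ! i" and len: "Suc j < length (P ! i)" and i: "i < length P"
      by (auto simp: cells_shape_iff row_def)
    define z where "z = P ! i ! Suc j"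
    have z: "z + s = Suc (Suc (l + j + i))" using ent_right step.hyps by (simp add: z_def)
    have xz: "x < z" using z step.prems step.hyps \<open>s \<le> r\<close> by (auto split: if_splits)
    \<comment> \<open>Column \<open>j\<close> holds \<open>l + j + i - r\<close>, which is at most
      \<open>x\<close> because \<open>s \<le> r\<close>; hence the box in column
      \<open>j + 1\<close> is the one to be bumped.\<close>
    have le: "P ! i ! b \<le> x" if "b < Suc j" for b
    proof -
      have "P ! i ! b \<le> P ! i ! j"
        using mono[of i j b] cell[of i] ir that by (cases "b = j") auto
      then show ?thesis using ent[of i] ir step.prems \<open>s \<le> r\<close> by (auto split: if_splits)
    qed
    have monoi: "P ! i ! b < P ! i ! b'" if "b < b'" "b' < length (P ! i)" for b b'
      using mono[of i b' b] that i by (simp add: cells_shape_iff)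
    have Min: "Min {z \<in> set (P ! i). x < z} = z"
      unfolding z_def using monoi len xz[unfolded z_def] le by (rule Min_greater_in_row)
    define P' where "P' = replace_in_row i z x P"
    have nth: "P' ! a ! b = (if a = i \<and> b = Suc j then x else P ! a ! b)"
      if "(a, b) \<in> cells (shape P)" for a b
      unfolding P'_def z_def using monoi cellR that by (rule nth_replace_in_row)
    have shape: "shape P' = shape P" by (simp add: P'_def shape_replace_in_row)
    \<comment> \<open>Replacing the entry would place \<open>x\<close> next to a copy of itself: on
      its left in row 0, below it in higher rows.\<close>
    have "\<not> increasing_tableau P'"
    proof
      assume incr: "increasing_tableau P'"
      show False
      proof (cases i)
        case 0
        have "P' ! 0 ! j = x" "(0, j) \<in> cells (shape P')"
          using nth[of 0 j] cell[of 0] ent[of 0] step.prems 0 shape by auto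
        moreover have "P' ! 0 ! Suc j = x" "(0, Suc j) \<in> cells (shape P')"
          using nth[OF cellR] cellR 0 shape by auto
        ultimately show False using incr unfolding increasing_tableau_def by (metis less_irrefl)
      next
        case (Suc i')
        have "P' ! i' ! Suc j = x" "(i', Suc j) \<in> cells (shape P')"
          using nth[of i' "Suc j"] right[of i'] ent_right[of i'] step Suc shape by auto
        moreover have "P' ! Suc i' ! Suc j = x" "(Suc i', Suc j) \<in> cells (shape P')"
          using nth[OF cellR] cellR Suc shape by auto
        ultimately show False using incr unfolding increasing_tableau_def by (metis less_irrefl)
      qed
    qed
    moreover have "\<not> (\<forall>z \<in> set (row P i). z \<le> x)"
      using xz len row unfolding z_def by (metis leD nth_mem)
    ultimately have "hecke_insert_row y i x (P, Q) = hecke_insert_row y (Suc i) z (P, Q)"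
      by (subst hecke_insert_row.simps) (auto simp: row Min P'_def Let_def)
    then show ?case
      using step.IH[of z] z by simp
  qed
qed

lemma hecke_insert_row_corner:
  assumes "reversed_contents l 0 j P" "shape Q = shape P" "is_corner (shape P) (r, j)" "x + r = l + j"
  shows "hecke_insert_row y 0 x (P, Q) = (P, Q[r := (Q ! r)[j := insert y (Q ! r ! j)]])"
proof -
  have "hecke_insert_row y 0 x (P, Q) = (P, add_to_corner j y Q)"
    using hecke_insert_row_corner_aux[OF assms(1,3) refl, of 0 x] assms(4) by simp
  then show ?thesis
    using add_to_corner_eq[of Q r j] assms by (simp add: reversed_contents_def)
qed

lemma reversed_contents_0: "reversed_contents l 0 j P \<longleftrightarrow> reversed_contents l 0 j' P"
  by (simp add: reversed_contents_def)

section \<open>Semistandard tableaux and their contents\<close>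

lemma semistandard_column_less:
  assumes T: "semistandard_set_valued lam T" and lam: "is_partition lam"
    and "(i', j) \<in> cells lam" "i < i'" "a \<in> T ! i ! j" "b \<in> T ! i' ! j"
  shows "a < b"
  using assms(4,3,5,6)
proof (induction i' arbitrary: b)
  case (Suc i')
  have cell: "(i', j) \<in> cells lam"
    by (rule cells_downward_closed[OF lam Suc.prems(2)]) auto
  have fin: "finite (T ! i' ! j)" "T ! i' ! j \<noteq> {}" "finite (T ! Suc i' ! j)"
    using T cell Suc.prems(2) unfolding semistandard_set_valued_def by auto
  have "Max (T ! i' ! j) < Min (T ! Suc i' ! j)"
    using T cell Suc.prems(2) unfolding semistandard_set_valued_def by blast
  also have "\<dots> \<le> b" using fin Suc.prems(4) by simp
  finally have less: "Max (T ! i' ! j) < b" .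
  show ?case
  proof (cases "i = i'")
    case True
    then have "a \<le> Max (T ! i' ! j)" using fin Suc.prems(3) by simp
    then show ?thesis using less by simp
  next
    \<comment> \<open>The largest entry of the cell in row \<open>i'\<close> serves as intermediate
      element; it exists because cells are finite and nonempty.\<close>
    case False
    then show ?thesis
      using Suc.IH[OF _ cell Suc.prems(3) Max_in[OF fin(1,2)]] Suc.prems(1) less by simp
  qed
qed simp

lemma semistandard_row_le:
  assumes T: "semistandard_set_valued lam T" and lam: "is_partition lam"
    and "(i, j') \<in> cells lam" "j < j'" "a \<in> T ! i ! j" "b \<in> T ! i ! j'"
  shows "a \<le> b"
  using assms(4,3,5,6)
proof (induction j' arbitrary: b)
  case (Suc j')
  have cell: "(i, j') \<in> cells lam"
    by (rule cells_downward_closed[OF lam Suc.prems(2)]) auto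
  have fin: "finite (T ! i ! j')" "T ! i ! j' \<noteq> {}" "finite (T ! i ! Suc j')"
    using T cell Suc.prems(2) unfolding semistandard_set_valued_def by auto
  have "Max (T ! i ! j') \<le> Min (T ! i ! Suc j')"
    using T cell Suc.prems(2) unfolding semistandard_set_valued_def by blast
  also have "\<dots> \<le> b" using fin Suc.prems(4) by simp
  finally have le: "Max (T ! i ! j') \<le> b" .
  show ?case
  proof (cases "j = j'")
    case True
    then have "a \<le> Max (T ! i ! j')" using fin Suc.prems(3) by simp
    then show ?thesis using le by simp
  next
    case False
    then show ?thesis
      using Suc.IH[OF _ cell Suc.prems(3) Max_in[OF fin(1,2)]] Suc.prems(1) le by simp
  qed
qed simp

lemma semistandard_nonempty:
  assumes "semistandard_set_valued lam T" "(i, j) \<in> cells lam"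
  shows "\<exists>a. a \<in> T ! i ! j"
  using assms by (auto simp: semistandard_set_valued_def)

text \<open>Distinct cells of equal content lie on a diagonal, one strictly above and to the right
  of the other. The cell in the row of the upper one and the column of the lower one would contain
  an entry \<open>a\<close> with \<open>k < a \<le> k\<close>. So an entry and a content together
  pin down one cell.\<close>

lemma content_eq_imp_cell_eq:
  assumes T: "semistandard_set_valued lam T" and lam: "is_partition lam"
    and "(i, j) \<in> cells lam" "(i', j') \<in> cells lam" "k \<in> T ! i ! j" "k \<in> T ! i' ! j'"
    and eq: "content lam (i, j) = content lam (i', j')"
  shows "i = i' \<and> j = j'"
proof -
  have False if cells: "(i, j) \<in> cells lam" "(i', j') \<in> cells lam" "k \<in> T ! i ! j" "k \<in> T ! i' ! j'"
    and less: "i < i'" "j < j'" for i j i' j'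
  proof -
    have corner: "(i', j) \<in> cells lam"
      by (rule cells_downward_closed[OF lam cells(2)]) (use less in auto)
    obtain a where a: "a \<in> T ! i' ! j"
      using semistandard_nonempty[OF T corner] by blast
    have "k < a" by (rule semistandard_column_less[OF T lam corner less(1) cells(3) a])
    moreover have "a \<le> k" by (rule semistandard_row_le[OF T lam cells(2) less(2) a cells(4)])
    ultimately show False by simp
  qed
  note diagonal = this
  \<comment> \<open>Row indices below the number of parts keep the subtraction in
    \<open>content\<close> from truncating.\<close>
  have "i < length lam" "i' < length lam" using assms(3,4) by (auto simp: cells_iff)
  then have "i < i' \<and> j < j' \<or> i' < i \<and> j' < j \<or> i = i' \<and> j = j'"
    using eq by (auto simp: content_def)
  then show ?thesis using diagonal[of i j i' j'] diagonal[of i' j' i j] assms by blast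
qed

section \<open>Building up the tableau along the biword\<close>

definition residue_pairs :: "nat set list list \<Rightarrow> (nat \<times> nat) set" where
  "residue_pairs T =
     {(k, content (shape T) (i, j)) | k i j. (i, j) \<in> cells (shape T) \<and> k \<in> T ! i ! j}"

text \<open>Describes the recording tableau once the pairs in \<open>D\<close> have been read. A
  cell enters together with its first entry, so cells without a recorded entry must be
  absent.\<close>

definition is_restriction :: "nat set list list \<Rightarrow> (nat \<times> nat) set \<Rightarrow> nat set list list \<Rightarrow> bool" where
  "is_restriction T D Q \<longleftrightarrow> is_partition (shape Q) \<and>
     (\<forall>i j. (i, j) \<in> cells (shape Q) \<longleftrightarrow>
        (i, j) \<in> cells (shape T) \<and> (\<exists>k \<in> T ! i ! j. (k, content (shape T) (i, j)) \<in> D)) \<and>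
     (\<forall>i j. (i, j) \<in> cells (shape Q) \<longrightarrow>
        Q ! i ! j = {k \<in> T ! i ! j. (k, content (shape T) (i, j)) \<in> D})"

abbreviation lex_less :: "((nat \<times> nat) \<times> (nat \<times> nat)) set" where
  "lex_less \<equiv> less_than <*lex*> less_than"

text \<open>Among the pairs of \<open>T\<close>, the set \<open>D\<close> consists of those
  lexicographically below \<open>(k, c)\<close>. The cell of \<open>(k, c)\<close> is either new,
  and then everything below it and to its left has been reached, or present, and then neither its
  upper nor its right neighbour has. These are the two kinds of insertion treated above.\<close>

lemma hecke_insert_residue:
  assumes T: "semistandard_set_valued (shape T) T" and lam: "is_partition (shape T)"
    and kc: "(k, c) \<in> residue_pairs T"
    and before: "\<And>q. q \<in> D \<Longrightarrow> (q, (k, c)) \<in> lex_less"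
    and after: "\<And>q. q \<in> residue_pairs T \<Longrightarrow> (q, (k, c)) \<in> lex_less \<Longrightarrow> q \<in> D"
    and Q: "is_restriction T D Q"
    and P: "reversed_contents (length T) 0 0 P" "shape P = shape Q"
    and ins: "hecke_insert_row k 0 c (P, Q) = (P', Q')"
  shows "is_restriction T (insert (k, c) D) Q'" "reversed_contents (length T) 0 0 P'" "shape P' = shape Q'"
proof -
  let ?l = "length T" and ?c = "content (shape T)"
  have len: "length (shape T) = ?l" by (simp add: shape_def)
  obtain r j where rj: "(r, j) \<in> cells (shape T)" "k \<in> T ! r ! j" and c: "c = ?c (r, j)"
    using kc by (auto simp: residue_pairs_def)
  have content: "?c (i, b) + i = ?l + b" if "(i, b) \<in> cells (shape T)" for i b
    using that by (auto simp: content_def cells_iff len)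
  have mem: "(k', ?c (i, b)) \<in> D \<longleftrightarrow> k' < k \<or> k' = k \<and> ?c (i, b) < c"
    if "(i, b) \<in> cells (shape T)" "k' \<in> T ! i ! b" for i b k'
  proof -
    have "(k', ?c (i, b)) \<in> residue_pairs T" using that by (auto simp: residue_pairs_def)
    then show ?thesis using before[of "(k', ?c (i, b))"] after[of "(k', ?c (i, b))"] by auto
  qed
  \<comment> \<open>Entry and content determine the cell, so the new pair changes the restriction
    only in \<open>(r, j)\<close>.\<close>
  have mem': "(k', ?c (i, b)) \<in> insert (k, c) D \<longleftrightarrow> (k', ?c (i, b)) \<in> D \<or> k' = k \<and> i = r \<and> b = j"
    if "(i, b) \<in> cells (shape T)" "k' \<in> T ! i ! b" for i b k'
    using content_eq_imp_cell_eq[OF T lam that(1) rj(1) _ rj(2)] that(2) c by auto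
  have part: "is_partition (shape Q)"
    and cellsQ: "(i, b) \<in> cells (shape Q) \<longleftrightarrow>
      (i, b) \<in> cells (shape T) \<and> (\<exists>k \<in> T ! i ! b. (k, ?c (i, b)) \<in> D)"
    and nthQ: "(i, b) \<in> cells (shape Q) \<Longrightarrow> Q ! i ! b = {k \<in> T ! i ! b. (k, ?c (i, b)) \<in> D}" for i b
    using Q by (auto simp: is_restriction_def)
  have cellsI: "(i, b) \<in> cells (shape Q)"
    if "(i, b) \<in> cells (shape T)" "a \<in> T ! i ! b" "a < k \<or> a = k \<and> ?c (i, b) < c" for i b a
    using that(1,2) cellsQ[of i b] mem[OF that(1,2)] that(3) by blast
  have cellsE: "\<exists>a \<in> T ! i ! b. a < k \<or> a = k \<and> ?c (i, b) < c" if cell: "(i, b) \<in> cells (shape Q)" for i b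
  proof -
    obtain a where "(i, b) \<in> cells (shape T)" "a \<in> T ! i ! b" "(a, ?c (i, b)) \<in> D"
      using cell cellsQ[of i b] by blast
    then show ?thesis using mem[of i b a] by blast
  qed
  have Pj: "reversed_contents ?l 0 j P" using P(1) reversed_contents_0 by blast
  have x: "c + r = ?l + j" using content[OF rj(1)] c by simp
  \<comment> \<open>The common end of both cases: \<open>(r, j)\<close> gains \<open>k\<close> and
    every other cell stays as it was.\<close>
  have restriction: "is_restriction T (insert (k, c) D) Q'"
    if "is_partition (shape Q')" "cells (shape Q') = insert (r, j) (cells (shape Q))"
      "Q' ! r ! j = insert k {k' \<in> T ! r ! j. (k', ?c (r, j)) \<in> D}"
      "\<And>i b. (i, b) \<in> cells (shape Q) \<Longrightarrow> (i, b) \<noteq> (r, j) \<Longrightarrow> Q' ! i ! b = Q ! i ! b"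
    unfolding is_restriction_def
  proof (intro conjI allI impI that(1))
    fix i b
    show "(i, b) \<in> cells (shape Q') \<longleftrightarrow>
      (i, b) \<in> cells (shape T) \<and> (\<exists>k' \<in> T ! i ! b. (k', ?c (i, b)) \<in> insert (k, c) D)"
    proof (cases "(i, b) = (r, j)")
      case True
      then show ?thesis using that(2) rj c by auto
    next
      case False
      then have "(k', ?c (i, b)) \<in> insert (k, c) D \<longleftrightarrow> (k', ?c (i, b)) \<in> D"
        if "(i, b) \<in> cells (shape T)" "k' \<in> T ! i ! b" for k'
        using mem'[OF that] by blast
      then show ?thesis using that(2) cellsQ[of i b] False by auto
    qed
    assume "(i, b) \<in> cells (shape Q')"
    then show "Q' ! i ! b = {k' \<in> T ! i ! b. (k', ?c (i, b)) \<in> insert (k, c) D}"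
    proof (cases "(i, b) = (r, j)")
      case True
      then show ?thesis using that(3) mem'[of r j] rj by auto
    next
      case False
      then have cell: "(i, b) \<in> cells (shape Q)"
        using that(2) \<open>(i, b) \<in> cells (shape Q')\<close> by blast
      then have "(i, b) \<in> cells (shape T)" using cellsQ by blast
      then show ?thesis using that(4)[OF cell False] nthQ[OF cell] mem'[of i b] False by auto
    qed
  qed
  have "is_restriction T (insert (k, c) D) Q' \<and> reversed_contents ?l 0 j P' \<and> shape P' = shape Q'"
  proof (cases "(r, j) \<in> cells (shape Q)")
    case False
    \<comment> \<open>Cells below \<open>(r, j)\<close> hold entries smaller than \<open>k\<close>,
      and cells to its left hold entries at most \<open>k\<close> with smaller contents; all their
      pairs have been read.\<close>
    have "(i, j) \<in> cells (shape Q)" if "i < r" for i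
    proof -
      have cell: "(i, j) \<in> cells (shape T)"
        by (rule cells_downward_closed[OF lam rj(1)]) (use that in auto)
      then obtain a where "a \<in> T ! i ! j" using semistandard_nonempty[OF T] by blast
      then show ?thesis
        using cellsI[OF cell] semistandard_column_less[OF T lam rj(1) that _ rj(2)] by blast
    qed
    moreover have "(r, b) \<in> cells (shape Q)" if "b < j" for b
    proof -
      have cell: "(r, b) \<in> cells (shape T)"
        by (rule cells_downward_closed[OF lam rj(1)]) (use that in auto)
      then obtain a where a: "a \<in> T ! r ! b" using semistandard_nonempty[OF T] by blast
      then have "a \<le> k" using semistandard_row_le[OF T lam rj(1) that _ rj(2)] by blast
      moreover have "?c (r, b) < c" using content[OF cell] x that by simp
      ultimately show ?thesis using cellsI[OF cell a] by (simp add: order_le_less)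
    qed
    ultimately have add: "addable (shape Q) r j" using False by (simp add: addable_def)
    have Q': "Q' = append_to_row r {k} Q" and P': "reversed_contents ?l 0 j P'" "shape P' = shape Q'"
      using hecke_insert_row_addable[OF Pj P(2)[symmetric] _ x ins] add P(2) by auto
    have "{k' \<in> T ! r ! j. (k', ?c (r, j)) \<in> D} = {}" using cellsQ[of r j] False rj(1) by blast
    then have "is_restriction T (insert (k, c) D) Q'"
      using append_to_row_addable(2-5)[OF part add, where x = "{k}"]
      by (intro restriction) (auto simp: Q')
    then show ?thesis using P' by simp
  next
    case True
    \<comment> \<open>Entries of the cell above exceed \<open>k\<close>, and those of the cell to
      the right are at least \<open>k\<close> with a larger content; none of them has been
      read.\<close>
    have "(Suc r, j) \<notin> cells (shape Q)"
    proof
      assume cell: "(Suc r, j) \<in> cells (shape Q)"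
      then have "(Suc r, j) \<in> cells (shape T)" using cellsQ by blast
      from semistandard_column_less[OF T lam this _ rj(2)] cellsE[OF cell] show False by fastforce
    qed
    moreover have "(r, Suc j) \<notin> cells (shape Q)"
    proof
      assume cell: "(r, Suc j) \<in> cells (shape Q)"
      then have cell': "(r, Suc j) \<in> cells (shape T)" using cellsQ by blast
      obtain a where a: "a \<in> T ! r ! Suc j" "a < k \<or> a = k \<and> ?c (r, Suc j) < c"
        using cellsE[OF cell] by blast
      have "k \<le> a" using semistandard_row_le[OF T lam cell' _ rj(2) a(1)] by simp
      then show False using a(2) content[OF cell'] x by simp
    qed
    ultimately have "is_corner (shape P) (r, j)" using True by (simp add: is_corner_def P(2))
    from hecke_insert_row_corner[OF Pj P(2)[symmetric] this x] ins
    have Q': "Q' = Q[r := (Q ! r)[j := insert k (Q ! r ! j)]]" and P': "P' = P" by auto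
    have shape: "shape Q' = shape Q" by (simp add: Q' shape_list_update)
    have "is_restriction T (insert (k, c) D) Q'"
    proof (rule restriction)
      show "is_partition (shape Q')" using part shape by simp
      show "cells (shape Q') = insert (r, j) (cells (shape Q))" using True shape by auto
      show "Q' ! r ! j = insert k {k' \<in> T ! r ! j. (k', ?c (r, j)) \<in> D}"
        using True nthQ[OF True] by (simp add: Q' cells_shape_iff)
      show "Q' ! i ! b = Q ! i ! b" if "(i, b) \<in> cells (shape Q)" "(i, b) \<noteq> (r, j)" for i b
        using that by (cases "i = r") (simp_all add: Q' cells_shape_iff)
    qed
    then show ?thesis using Pj P' P(2) shape by simp
  qed
  then show "is_restriction T (insert (k, c) D) Q'" "reversed_contents ?l 0 0 P'" "shape P' = shape Q'"
    using reversed_contents_0 by blast+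
qed

text \<open>Letters are processed from the right, so the head of \<open>w\<close> comes last and the
  tail gives the state before it. Descending order makes the tail again a lower set among the pairs
  of \<open>T\<close>, as the one-letter step requires.\<close>

lemma hecke_insertion_lower_set:
  assumes T: "semistandard_set_valued (shape T) T" and lam: "is_partition (shape T)"
    and "sorted_wrt (\<lambda>p q. (q, p) \<in> lex_less) w" "set w \<subseteq> residue_pairs T"
    and "\<And>p q. p \<in> set w \<Longrightarrow> q \<in> residue_pairs T \<Longrightarrow> (q, p) \<in> lex_less \<Longrightarrow> q \<in> set w"
    and "hecke_insertion w = (P, Q)"
  shows "is_restriction T (set w) Q \<and> reversed_contents (length T) 0 0 P \<and> shape P = shape Q"
  using assms(3-)
proof (induction w arbitrary: P Q)
  case Nil
  then show ?case
    by (auto simp: hecke_insertion_def is_restriction_def reversed_contents_def shape_def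
        is_partition_def cells_def)
next
  case (Cons p w)
  obtain k c where p: "p = (k, c)" by (cases p)
  obtain P0 Q0 where 0: "hecke_insertion w = (P0, Q0)" by (cases "hecke_insertion w")
  have ins: "hecke_insert_row k 0 c (P0, Q0) = (P, Q)"
    using Cons.prems(4) 0 by (simp add: hecke_insertion_def p)
  have before: "(q, (k, c)) \<in> lex_less" if "q \<in> set w" for q
    using Cons.prems(1) that p by simp
  have after: "q \<in> set w" if "q \<in> residue_pairs T" "(q, (k, c)) \<in> lex_less" for q
    using Cons.prems(3)[of p q] that p by auto
  \<comment> \<open>By transitivity a pair below a letter of the tail is below the head.\<close>
  have "q \<in> set w" if "p' \<in> set w" "q \<in> residue_pairs T" "(q, p') \<in> lex_less" for p' q
  proof (rule after)
    show "(q, (k, c)) \<in> lex_less"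
      using that(3) before[OF that(1)] by (cases q; cases p') auto
  qed (rule that(2))
  then have IH: "is_restriction T (set w) Q0" "reversed_contents (length T) 0 0 P0" "shape P0 = shape Q0"
    using Cons.IH[OF _ _ _ 0] Cons.prems(1,2) by auto
  have "(k, c) \<in> residue_pairs T" using Cons.prems(2) p by simp
  from hecke_insert_residue[OF T lam this before after IH ins] p show ?case by simp
qed

text \<open>With every pair read no entry is cut away, and since the cells of \<open>T\<close> are
  nonempty no cell is dropped either.\<close>

lemma is_restriction_residue_pairs:
  assumes T: "semistandard_set_valued (shape T) T" and lam: "is_partition (shape T)"
    and Q: "is_restriction T (residue_pairs T) Q"
  shows "Q = T"
proof -
  have all: "(k, content (shape T) (i, j)) \<in> residue_pairs T"
    if "(i, j) \<in> cells (shape T)" "k \<in> T ! i ! j" for i j k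
    using that by (auto simp: residue_pairs_def)
  have "cells (shape Q) = cells (shape T)"
    using Q all semistandard_nonempty[OF T] by (auto simp: is_restriction_def)
  then have shape: "shape Q = shape T"
    using Q lam by (auto simp: is_restriction_def intro: cells_inject)
  have nth: "Q ! i ! j = T ! i ! j" if "(i, j) \<in> cells (shape T)" for i j
    using Q all[OF that] that shape by (auto simp: is_restriction_def)
  have len: "length Q = length T"
    using shape by (metis length_map shape_def)
  show ?thesis
  proof (rule nth_equalityI[OF len], rule nth_equalityI)
    fix i assume i: "i < length Q"
    then show leni: "length (Q ! i) = length (T ! i)"
      using shape len by (metis nth_map shape_def)
    fix j assume "j < length (Q ! i)"
    then show "Q ! i ! j = T ! i ! j"
      using nth i leni len by (simp add: cells_shape_iff)
  qed
qed

section \<open>The biword of a tableau\<close>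

lemma hecke_biword_res:
  "hecke_biword (res m T) = concat (map (\<lambda>k. map (Pair k) (res_factor T k)) (rev [1..<Suc m]))"
proof -
  \<comment> \<open>The word has \<open>m\<close> factors, so its labels are the very indices over
    which \<open>res\<close> maps, and zipping pairs each index with its own factor.\<close>
  have "map2 f xs (map g xs) = map (\<lambda>x. f x (g x)) xs" for f :: "nat \<Rightarrow> nat list \<Rightarrow> (nat \<times> nat) list" and g xs
    by (induction xs) auto
  then show ?thesis by (simp add: hecke_biword_def res_def del: upt_Suc)
qed

lemma set_res_factor:
  "set (res_factor T k) = {c. (k, c) \<in> residue_pairs T}"
proof -
  have "finite {(i, j). (i, j) \<in> cells (shape T) \<and> k \<in> T ! i ! j}"
    by (rule finite_subset[OF _ finite_cells[of "shape T"]]) auto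
  then show ?thesis by (auto simp: res_factor_def residue_pairs_def image_iff)
qed

lemma set_hecke_biword_res:
  "set (hecke_biword (res m T)) = {(k, c) \<in> residue_pairs T. k \<in> {1..m}}"
  by (auto simp: hecke_biword_res set_res_factor image_iff less_Suc_eq_le simp del: upt_Suc)

text \<open>Labels descend from factor to factor; within a factor the contents descend strictly,
  being listed from a set.\<close>

lemma sorted_wrt_hecke_biword_res:
  "sorted_wrt (\<lambda>p q. (q, p) \<in> lex_less) (hecke_biword (res m T))"
proof -
  have factor: "sorted_wrt (\<lambda>p q. (q, p) \<in> lex_less) (map (Pair k) (res_factor T k))" for k
    by (simp add: sorted_wrt_map res_factor_def sorted_wrt_rev)
  show ?thesis
    unfolding hecke_biword_res
    by (induction m) (auto simp: sorted_wrt_append factor)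
qed

theorem theorem3p5:
  fixes lam :: "nat list" and m :: nat and T Q :: "nat set list list"
    and P hs :: "nat list list" and w :: "(nat \<times> nat) list"
  assumes "is_partition lam"
    and "semistandard_set_valued lam T"
    and "entries T \<subseteq> {1..m}"
    and "hs = res m T"
    and "w = hecke_biword hs"
    and "hecke_insertion w = (P, Q)"
  shows "Q = T"
proof -
  have shape: "shape T = lam"
    using assms(2) by (simp add: semistandard_set_valued_def)
  note T = assms(2)[folded shape] and lam = assms(1)[folded shape]
  \<comment> \<open>The bound on the entries ensures that the factors for \<open>1\<close> to
    \<open>m\<close> exhaust the pairs of \<open>T\<close>.\<close>
  have "k \<in> {1..m}" if "(k, c) \<in> residue_pairs T" for k c
    using that assms(3) unfolding residue_pairs_def entries_def by blast
  then have set: "set w = residue_pairs T"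
    unfolding assms(4,5) set_hecke_biword_res by auto
  have "sorted_wrt (\<lambda>p q. (q, p) \<in> lex_less) w"
    unfolding assms(4,5) by (rule sorted_wrt_hecke_biword_res)
  \<comment> \<open>The word contains every pair of \<open>T\<close>, so it is trivially a lower
    set.\<close>
  then have "is_restriction T (residue_pairs T) Q"
    using hecke_insertion_lower_set[OF T lam, of w P Q] assms(6) set by simp
  then show ?thesis
    by (rule is_restriction_residue_pairs[OF T lam])
qed

end
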